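(* Let $(1,g_2,g_3,g_4,g_5)$, $g_i\in\mathrm{SU}(2)$, represent a point of $\Pi(5)$, and let $p,q_j,r_j,t_{ij}$ be the entries of the matrix of its spectral form. Let $\widetilde p,\widetilde q_j,\widetilde r_j,\widetilde t_{ij}$ be the corresponding entries for the tuple $(1,g_2^{-1},g_3,g_4,g_5)$. Then $$\widetilde p=p;\qquad\widetilde q_j=q_j;\qquad\widetilde t_{ij}=t_{ij};\qquad\widetilde r_j=-r_j+2pq_j$$ for all $i,j\in\{1,2,3\}$, $i\neq j$. That is, the transformation $g_2\mapsto g_2^{-1}$ of $\Pi(5)$ corresponds to the map $\Xi(5)\to\Xi(5)$ given by these formulas.
   Context: $\Pi(5)$ is the set of $5$-tuples in $\mathrm{SU}(2)$ modulo $(g_1,\dots,g_5)\sim(hg_1q,\dots,hg_5q)$, $h,q\in\mathrm{SU}(2)$; equivalently the set of tuples $(1,g_2,\dots,g_5)$ modulo simultaneous conjugation. The spectral form of $(g_1,\dots,g_5)$ is the quadratic form $\det(\lambda g_1+\mu g_2+\nu_1g_3+\nu_2g_4+\nu_3g_5)$ in real variables $\lambda,\mu,\nu_1,\nu_2,\nu_3$; its symmetric matrix (in this order of variables) is denoted $$\begin{pmatrix} 1 & p & q_1 & q_2 & q_3 \\ p & 1 & r_1 & r_2 & r_3 \\ q_1 & r_1 & 1 & t_{12} & t_{13} \\ q_2 & r_2 & t_{12} & 1 & t_{23} \\ q_3 & r_3 & t_{13} & t_{23} & 1 \end{pmatrix}.$$ $\Xi(5)$ is the set of real positive semidefinite quadratic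 forms in $5$ variables of rank at most $4$ whose symmetric matrix has unit diagonal; the spectral form defines a map $\Pi(5)\to\Xi(5)$. *)

theory Defs
  imports "HOL-Analysis.Analysis"
begin

section \<open>The space of five-tuples in SU(2)\<close>

definition SU2 :: "(complex^2^2) set" where
  "SU2 = {A. A ** (\<chi> i j. cnj (A $ j $ i)) = mat 1 \<and> det A = 1}"

text \<open>The index type \<^typ>\<open>5\<close> is arithmetic modulo 5, so that its elements are
  1, 2, 3, 4 and 5 = 0. An index \<open>j\<close> ranging over 1, 2, 3 is \<open>j \<in> {1, 2, 3}\<close>, never \<open>j \<le> 3\<close>.\<close>

definition SU2_tuples :: "(complex^2^2^5) set" where
  "SU2_tuples = {g. \<forall>i. g $ i \<in> SU2}"

definition tuple_rel :: "((complex^2^2^5) \<times> (complex^2^2^5)) set" where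
  "tuple_rel = {(g, g'). g \<in> SU2_tuples \<and> g' \<in> SU2_tuples \<and>
     (\<exists>h\<in>SU2. \<exists>q\<in>SU2. \<forall>i. g' $ i = h ** g $ i ** q)}"

definition Pi5 :: "(complex^2^2^5) set set" where
  "Pi5 = SU2_tuples // tuple_rel"

definition tuple_class :: "complex^2^2^5 \<Rightarrow> (complex^2^2^5) set" where
  "tuple_class g = tuple_rel `` {g}"

definition invert2 :: "complex^2^2^5 \<Rightarrow> complex^2^2^5" where
  "invert2 g = (\<chi> i. if i = 2 then matrix_inv (g $ i) else g $ i)"

text \<open>The transformation of the quotient is computed on the representatives whose first
  component is the identity; independence of the representative means that all sets in the
  union coincide.\<close>

definition Pi5_invert2 :: "(complex^2^2^5) set \<Rightarrow> (complex^2^2^5) set" where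
  "Pi5_invert2 c = (\<Union>g\<in>{g \<in> c. g $ 1 = mat 1}. tuple_class (invert2 g))"

section \<open>Real quadratic forms in five variables\<close>

definition form_of :: "real^5^5 \<Rightarrow> real^5 \<Rightarrow> real" where
  "form_of M x = x \<bullet> (M *v x)"

definition is_quadratic_form :: "(real^5 \<Rightarrow> real) \<Rightarrow> bool" where
  "is_quadratic_form Q \<longleftrightarrow> (\<exists>M. transpose M = M \<and> Q = form_of M)"

definition form_matrix :: "(real^5 \<Rightarrow> real) \<Rightarrow> real^5^5" where
  "form_matrix Q = (THE M. transpose M = M \<and> Q = form_of M)"

definition Xi5 :: "(real^5 \<Rightarrow> real) set" where
  "Xi5 = {Q. is_quadratic_form Q \<and> (\<forall>x. Q x \<ge> 0) \<and> rank (form_matrix Q) \<le> 4 \<and>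
     (\<forall>i. form_matrix Q $ i $ i = 1)}"

definition entry_p :: "real^5^5 \<Rightarrow> real" where
  "entry_p M = M $ 1 $ 2"

definition entry_q :: "real^5^5 \<Rightarrow> 5 \<Rightarrow> real" where
  "entry_q M j = M $ 1 $ (j + 2)"

definition entry_r :: "real^5^5 \<Rightarrow> 5 \<Rightarrow> real" where
  "entry_r M j = M $ 2 $ (j + 2)"

definition entry_t :: "real^5^5 \<Rightarrow> 5 \<Rightarrow> 5 \<Rightarrow> real" where
  "entry_t M i j = M $ (i + 2) $ (j + 2)"

text \<open>In the following matrix every entry of \<open>M\<close> is kept, except that \<open>r\<^sub>j\<close> is replaced by
  \<open>- r\<^sub>j + 2 p q\<^sub>j\<close> at both of its positions.\<close>

definition flip_matrix :: "real^5^5 \<Rightarrow> real^5^5" where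
  "flip_matrix M = (\<chi> k l.
     if k = 2 \<and> l \<in> {3, 4, 5} then - entry_r M (l - 2) + 2 * entry_p M * entry_q M (l - 2)
     else if l = 2 \<and> k \<in> {3, 4, 5} then - entry_r M (k - 2) + 2 * entry_p M * entry_q M (k - 2)
     else M $ k $ l)"

definition Xi5_flip :: "(real^5 \<Rightarrow> real) \<Rightarrow> real^5 \<Rightarrow> real" where
  "Xi5_flip Q = form_of (flip_matrix (form_matrix Q))"

section \<open>The spectral form\<close>

text \<open>The determinant is real for tuples in SU(2), see \<open>det_eq_spectral_form\<close> below;
  \<^const>\<open>Re\<close> only changes its type.\<close>

definition spectral_form :: "complex^2^2^5 \<Rightarrow> real^5 \<Rightarrow> real" where
  "spectral_form g x = Re (det (\<Sum>i\<in>UNIV. x $ i *\<^sub>R g $ i))"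

definition spectral_map :: "(complex^2^2^5) set \<Rightarrow> real^5 \<Rightarrow> real" where
  "spectral_map c = the_elem (spectral_form ` c)"

section \<open>Well-definedness\<close>

lemma form_of_eqD:
  assumes "transpose M = M" "transpose N = N" "form_of M = form_of N"
  shows "M = N"
proof -
  have ax: "axis i 1 \<bullet> (A *v axis j 1) = A $ i $ j" for A :: "real^5^5" and i j
    unfolding matrix_vector_mult_basis inner_axis' by (simp add: column_def)
  have sym: "A $ j $ i = A $ i $ j" if "transpose A = A" for A :: "real^5^5" and i j
    using arg_cong[OF that, of "\<lambda>B. B $ i $ j"] by (simp add: transpose_def)
  have pol: "form_of A (axis i 1 + axis j 1) - form_of A (axis i 1) - form_of A (axis j 1)
      = A $ i $ j + A $ j $ i" for A i j
    unfolding form_of_def matrix_vector_right_distrib inner_add_left inner_add_right ax by simp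
  have "M $ i $ j = N $ i $ j" for i j
    using pol[of M i j] pol[of N i j] sym[OF assms(1), of j i] sym[OF assms(2), of j i]
    unfolding assms(3) by linarith
  then show ?thesis by (simp add: vec_eq_iff)
qed

lemma form_matrix_form_of: "transpose M = M \<Longrightarrow> form_matrix (form_of M) = M"
  unfolding form_matrix_def by (rule the_equality) (auto dest: form_of_eqD)

lemma SU2_entries:
  assumes "A \<in> SU2"
  shows "A $ 2 $ 2 = cnj (A $ 1 $ 1)" "A $ 2 $ 1 = - cnj (A $ 1 $ 2)"
proof -
  let ?a = "A $ 1 $ 1" and ?b = "A $ 1 $ 2" and ?c = "A $ 2 $ 1" and ?d = "A $ 2 $ 2"
  have m: "(A ** (\<chi> i j. cnj (A $ j $ i))) $ i $ j = mat 1 $ i $ j" for i j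
    using assms by (simp add: SU2_def)
  have 1: "?a * cnj ?a + ?b * cnj ?b = 1"
    using m[of 1 1] by (simp add: matrix_matrix_mult_def sum_2 mat_def)
  have 2: "?c * cnj ?a + ?d * cnj ?b = 0"
    using m[of 2 1] by (simp add: matrix_matrix_mult_def sum_2 mat_def)
  have 3: "?a * ?d - ?b * ?c = 1"
    using assms by (simp add: SU2_def det_2)
  show "?d = cnj ?a" using 1 2 3 by algebra
  show "?c = - cnj ?b" using 1 2 3 by algebra
qed

lemma det_eq_norms:
  assumes "g \<in> SU2_tuples"
  shows "det (\<Sum>i\<in>UNIV. x $ i *\<^sub>R g $ i) =
    complex_of_real ((cmod (\<Sum>i\<in>UNIV. x $ i *\<^sub>R g $ i $ 1 $ 1))\<^sup>2 +
                     (cmod (\<Sum>i\<in>UNIV. x $ i *\<^sub>R g $ i $ 1 $ 2))\<^sup>2)"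
proof -
  have "g $ i \<in> SU2" for i using assms by (simp add: SU2_tuples_def)
  note e = SU2_entries[OF this]
  show ?thesis
    unfolding of_real_add complex_norm_square
    by (simp add: det_2 e sum_negf cnj_sum[symmetric]
        complex_cnj_scaleR[symmetric] del: cnj_sum complex_cnj_scaleR)
qed

lemma det_eq_spectral_form:
  "g \<in> SU2_tuples \<Longrightarrow>
    det (\<Sum>i\<in>UNIV. x $ i *\<^sub>R g $ i) = complex_of_real (spectral_form g x)"
  unfolding spectral_form_def by (subst (1 2) det_eq_norms) auto

lemma is_quadratic_form_spectral_form:
  assumes "g \<in> SU2_tuples"
  shows "is_quadratic_form (spectral_form g)"
proof -
  define M :: "real^5^5" where
    "M = (\<chi> i j. g $ i $ 1 $ 1 \<bullet> g $ j $ 1 $ 1 + g $ i $ 1 $ 2 \<bullet> g $ j $ 1 $ 2)"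
  have "transpose M = M"
    by (simp add: M_def transpose_def vec_eq_iff inner_commute)
  moreover have "spectral_form g x = form_of M x" for x
  proof -
    have "spectral_form g x =
        (cmod (\<Sum>i\<in>UNIV. x $ i *\<^sub>R g $ i $ 1 $ 1))\<^sup>2 +
        (cmod (\<Sum>i\<in>UNIV. x $ i *\<^sub>R g $ i $ 1 $ 2))\<^sup>2"
      unfolding spectral_form_def by (subst det_eq_norms[OF assms]) (rule Re_complex_of_real)
    also have "\<dots> = form_of M x"
    proof -
      have "form_of M x = (\<Sum>i\<in>UNIV. \<Sum>j\<in>UNIV. x $ i * (M $ i $ j * x $ j))"
        by (simp add: form_of_def inner_vec_def matrix_vector_mult_def sum_distrib_left)
      moreover have "(cmod (\<Sum>i\<in>UNIV. x $ i *\<^sub>R f i))\<^sup>2 =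
          (\<Sum>i\<in>UNIV. \<Sum>j\<in>UNIV. x $ i * ((f i \<bullet> f j) * x $ j))" for f
        unfolding power2_norm_eq_inner inner_sum_left inner_sum_right
        by (subst sum.swap) (simp add: mult_ac inner_commute)
      ultimately show ?thesis
        by (simp add: M_def distrib_left distrib_right sum.distrib)
    qed
    finally show ?thesis .
  qed
  ultimately show ?thesis unfolding is_quadratic_form_def by blast
qed

lemma spectral_form_cong:
  assumes "(g, g') \<in> tuple_rel"
  shows "spectral_form g' = spectral_form g"
proof
  fix x
  obtain h q where hq: "h \<in> SU2" "q \<in> SU2" "\<And>i. g' $ i = h ** g $ i ** q"
    using assms by (auto simp: tuple_rel_def)
  have lin: "linear (\<lambda>A. h ** A ** q)"
    by (rule linearI)
      (simp_all add: vec_eq_iff matrix_matrix_mult_def sum_2 distrib_left distrib_right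
        scaleR_right_distrib)
  have "(\<Sum>i\<in>UNIV. x $ i *\<^sub>R g' $ i) = h ** (\<Sum>i\<in>UNIV. x $ i *\<^sub>R g $ i) ** q"
    by (simp add: hq(3) linear_sum[OF lin] linear_cmul[OF lin])
  then show "spectral_form g' x = spectral_form g x"
    using hq by (simp add: spectral_form_def det_mul SU2_def)
qed

lemma spectral_map_tuple_class:
  assumes "g \<in> SU2_tuples"
  shows "spectral_map (tuple_class g) = spectral_form g"
proof -
  have "mat 1 \<in> SU2"
    by (simp add: SU2_def mat_def vec_eq_iff matrix_matrix_mult_def sum_2 det_2 forall_2)
  then have "(g, g) \<in> tuple_rel" using assms
    by (auto simp: tuple_rel_def intro!: bexI[of _ "mat 1"])
  then have "spectral_form ` tuple_class g = {spectral_form g}"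
    by (auto simp: tuple_class_def dest: spectral_form_cong)
  then show ?thesis by (simp add: spectral_map_def)
qed

end

theory Submission
  imports Defs
begin

text \<open>When \<open>g\<^sub>1 = 1\<close>, the Cayley-Hamilton theorem gives \<open>g\<^sub>2\<^sup>-\<^sup>1 = 2 p g\<^sub>1 - g\<^sub>2\<close>, since the trace of
  \<open>g\<^sub>2\<close> is \<open>2 p\<close>. Inverting \<open>g\<^sub>2\<close> is therefore a linear substitution \<open>P\<close> of the variables of the
  spectral form, and its matrix \<open>M\<close> is replaced by \<open>P\<^sup>T M P\<close>, which is the flipped matrix. Being a
  congruence, the flip preserves positive semidefiniteness and does not increase the rank.\<close>

section \<open>The five-element index type\<close>

lemma UNIV_5: "(UNIV :: 5 set) = {1, 2, 3, 4, 5}"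
proof -
  have "card {1, 2, 3, 4, 5 :: 5} = CARD(5)" by simp
  then show ?thesis by (metis card_subset_eq finite_class.finite_UNIV subset_UNIV)
qed

lemma forall_5: "(\<forall>i::5. P i) \<longleftrightarrow> P 1 \<and> P 2 \<and> P 3 \<and> P 4 \<and> P 5"
  using UNIV_5 by (metis UNIV_I emptyE insertE)

lemma sum_5: "sum f (UNIV :: 5 set) = f 1 + f 2 + f 3 + f 4 + f 5"
  unfolding UNIV_5 by (simp add: add.assoc)

subsection \<open>The group SU(2)\<close>

definition adj :: "complex^2^2 \<Rightarrow> complex^2^2" where
  "adj A = (\<chi> i j. cnj (A $ j $ i))"

lemma adj_adj: "adj (adj A) = A"
  by (simp add: adj_def vec_eq_iff)

lemma adj_mul: "adj (A ** B) = adj B ** adj A"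
  by (simp add: adj_def vec_eq_iff matrix_matrix_mult_def mult.commute)

lemma SU2_iff: "A \<in> SU2 \<longleftrightarrow> A ** adj A = mat 1 \<and> det A = 1"
  by (simp add: SU2_def adj_def)

lemma SU2_adj_left: "A \<in> SU2 \<Longrightarrow> adj A ** A = mat 1"
  by (simp add: SU2_iff matrix_left_right_inverse)

lemma SU2_adj_right: "A \<in> SU2 \<Longrightarrow> A ** adj A = mat 1"
  by (simp add: SU2_iff)

lemma SU2_one: "mat 1 \<in> SU2"
  by (simp add: SU2_def mat_def vec_eq_iff matrix_matrix_mult_def sum_2 det_2 forall_2)

lemma SU2_mul:
  assumes "A \<in> SU2" "B \<in> SU2"
  shows "A ** B \<in> SU2"
proof -
  have "(A ** B) ** adj (A ** B) = A ** (B ** adj B) ** adj A"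
    by (simp add: adj_mul matrix_mul_assoc)
  then show ?thesis using assms by (simp add: SU2_iff det_mul)
qed

lemma SU2_adj:
  assumes "A \<in> SU2"
  shows "adj A \<in> SU2"
proof -
  have "det (adj A) = cnj (det A)"
    by (simp add: det_2 adj_def mult.commute)
  then show ?thesis using assms SU2_adj_left[OF assms] by (simp add: SU2_iff adj_adj)
qed

text \<open>\<open>matrix_inv\<close> merely chooses some two-sided inverse; \<open>adj A\<close>
  shows that one exists, and cancellation shows that it is the only one.\<close>

lemma matrix_inv_SU2: "matrix_inv A = adj A" if "A \<in> SU2"
proof -
  have "A ** matrix_inv A = mat 1"
    unfolding matrix_inv_def by (rule someI2[of _ "adj A"])
      (simp_all add: that SU2_adj_left SU2_adj_right)
  then show ?thesis
    using SU2_adj_left[OF that] by (metis matrix_mul_assoc matrix_mul_lid matrix_mul_rid)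
qed

text \<open>Cayley-Hamilton with determinant 1: \<open>A\<close> plus its inverse is the trace times
  the identity, and the trace is twice \<open>Re (A $ 1 $ 1)\<close>.\<close>

lemma adj_SU2_linear:
  assumes "A \<in> SU2"
  shows "adj A = (2 * Re (A $ 1 $ 1)) *\<^sub>R mat 1 - A"
  using SU2_entries[OF assms]
  by (simp add: adj_def vec_eq_iff forall_2 mat_def complex_eq_iff)

subsection \<open>The space of tuples modulo equivalence\<close>

text \<open>These are the orbits of the group SU(2) x SU(2) acting by left and right
  multiplication.\<close>

lemma equiv_tuple_rel: "equiv SU2_tuples tuple_rel"
proof (rule equivI)
  show "refl_on SU2_tuples tuple_rel"
    using SU2_one by (auto simp: refl_on_def tuple_rel_def intro!: bexI[of _ "mat 1"])
  show "sym tuple_rel"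
  proof (rule symI)
    fix g g' assume "(g, g') \<in> tuple_rel"
    then obtain h q where *: "g \<in> SU2_tuples" "g' \<in> SU2_tuples" "h \<in> SU2" "q \<in> SU2"
      "\<And>i. g' $ i = h ** g $ i ** q" by (auto simp: tuple_rel_def)
    have "adj h ** g' $ i ** adj q = (adj h ** h) ** g $ i ** (q ** adj q)" for i
      by (simp add: *(5) matrix_mul_assoc)
    then have "g $ i = adj h ** g' $ i ** adj q" for i
      using * by (simp add: SU2_adj_left SU2_adj_right)
    then show "(g', g) \<in> tuple_rel"
      using * SU2_adj unfolding tuple_rel_def by blast
  qed
  show "trans tuple_rel"
  proof (rule transI)
    fix g g' g'' assume "(g, g') \<in> tuple_rel" "(g', g'') \<in> tuple_rel"
    then obtain h q h' q' where *: "g \<in> SU2_tuples" "g'' \<in> SU2_tuples"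
      "h \<in> SU2" "q \<in> SU2" "h' \<in> SU2" "q' \<in> SU2"
      "\<And>i. g' $ i = h ** g $ i ** q" "\<And>i. g'' $ i = h' ** g' $ i ** q'"
      unfolding tuple_rel_def by blast
    have "g'' $ i = (h' ** h) ** g $ i ** (q ** q')" for i
      by (simp add: *(7,8) matrix_mul_assoc)
    then show "(g, g'') \<in> tuple_rel"
      using * SU2_mul unfolding tuple_rel_def by blast
  qed
qed (auto simp: tuple_rel_def)

lemma tuple_class_eqI: "(g, g') \<in> tuple_rel \<Longrightarrow> tuple_class g = tuple_class g'"
  unfolding tuple_class_def by (rule equiv_class_eq[OF equiv_tuple_rel])

lemma Pi5_cases:
  assumes "c \<in> Pi5"
  obtains g where "g \<in> SU2_tuples" "g $ 1 = mat 1" "c = tuple_class g"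
proof -
  obtain g where g: "g \<in> SU2_tuples" "c = tuple_class g"
    using assms by (auto simp: Pi5_def tuple_class_def quotient_def)
  then have i: "g $ i \<in> SU2" for i by (simp add: SU2_tuples_def)
  \<comment> \<open>Left multiplication by the inverse of \<open>g $ 1\<close> normalizes the first
    component.\<close>
  define g' where "g' = (\<chi> i. adj (g $ 1) ** g $ i)"
  have "g' \<in> SU2_tuples" by (simp add: g'_def SU2_tuples_def i SU2_mul SU2_adj)
  moreover have "g' $ 1 = mat 1" by (simp add: g'_def i SU2_adj_left)
  moreover have "(g, g') \<in> tuple_rel"
  proof -
    have "g' $ k = adj (g $ 1) ** g $ k ** mat 1" for k by (simp add: g'_def)
    then show ?thesis
      using g(1) \<open>g' \<in> SU2_tuples\<close> SU2_one SU2_adj[OF i] unfolding tuple_rel_def by blast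
  qed
  ultimately show ?thesis using that g(2) tuple_class_eqI by blast
qed

lemma invert2_SU2_tuples: "g \<in> SU2_tuples \<Longrightarrow> invert2 g \<in> SU2_tuples"
  by (simp add: SU2_tuples_def invert2_def matrix_inv_SU2 SU2_adj)

text \<open>Between normalized tuples the relation forces \<open>h ** q = mat 1\<close>, so it is
  simultaneous conjugation, which commutes with inversion.\<close>

lemma invert2_tuple_rel:
  assumes "(g, g') \<in> tuple_rel" "g $ 1 = mat 1" "g' $ 1 = mat 1"
  shows "(invert2 g, invert2 g') \<in> tuple_rel"
proof -
  obtain h q where *: "g \<in> SU2_tuples" "g' \<in> SU2_tuples" "h \<in> SU2" "q \<in> SU2"
    "\<And>i. g' $ i = h ** g $ i ** q" using assms(1) by (auto simp: tuple_rel_def)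
  have "h ** q = mat 1" using *(5)[of 1] assms(2,3) by simp
  then have "q = adj h"
    using SU2_adj_left[OF *(3)] by (metis matrix_mul_assoc matrix_mul_lid matrix_mul_rid)
  moreover have "g $ 2 \<in> SU2" "g' $ 2 \<in> SU2" using * by (auto simp: SU2_tuples_def)
  ultimately have "invert2 g' $ i = h ** invert2 g $ i ** q" for i
    using *(5) by (simp add: invert2_def matrix_inv_SU2 adj_mul adj_adj matrix_mul_assoc)
  then show ?thesis
    using * invert2_SU2_tuples unfolding tuple_rel_def by blast
qed

text \<open>The union is over a nonempty family, since \<open>g\<close> itself is normalized, and
  all its members are equal by \<open>invert2_tuple_rel\<close>.\<close>

lemma Pi5_invert2_tuple_class:
  assumes "g \<in> SU2_tuples" "g $ 1 = mat 1"
  shows "Pi5_invert2 (tuple_class g) = tuple_class (invert2 g)"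
proof -
  have "g \<in> tuple_class g"
    unfolding tuple_class_def by (rule equiv_class_self[OF equiv_tuple_rel assms(1)])
  moreover have "tuple_class (invert2 g') = tuple_class (invert2 g)"
    if "g' \<in> tuple_class g" "g' $ 1 = mat 1" for g'
    using that assms invert2_tuple_rel tuple_class_eqI unfolding tuple_class_def by blast
  ultimately show ?thesis using assms(2) unfolding Pi5_invert2_def by blast
qed

subsection \<open>The flip as a congruence\<close>

lemma inner_transpose_mult: "x \<bullet> (transpose A *v y) = (A *v x) \<bullet> y"
  for A :: "real^'n^'m"
  by (metis dot_lmul_matrix inner_commute transpose_matrix_vector)

lemma form_of_congruence: "form_of (transpose P ** M ** P) x = form_of M (P *v x)"
  unfolding form_of_def matrix_vector_mul_assoc[symmetric] inner_transpose_mult ..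

lemma transpose_congruence:
  "transpose M = M \<Longrightarrow> transpose (transpose P ** M ** P) = transpose P ** M ** P"
  for M :: "real^'n^'n"
  by (simp add: matrix_transpose_mul matrix_mul_assoc)

text \<open>The substitution matrix P: column 2 holds the coefficients of 2 p g_1 - g_2, and the
  other columns are those of the identity.\<close>

definition flip_base :: "real \<Rightarrow> real^5^5" where
  "flip_base p = (\<chi> i j. if j = 2 then (if i = 1 then 2 * p else if i = 2 then - 1 else 0)
     else if i = j then 1 else 0)"

lemma flip_base_mult:
  "flip_base p *v x =
    (\<chi> i. if i = 1 then x $ 1 + 2 * p * x $ 2 else if i = 2 then - x $ 2 else x $ i)"
  by (simp add: flip_base_def vec_eq_iff matrix_vector_mult_def sum_5 forall_5)

lemma mult_flip_base:
  "(M ** flip_base p) $ k $ l = (if l = 2 then 2 * p * M $ k $ 1 - M $ k $ 2 else M $ k $ l)"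
proof -
  \<comment> \<open>Quantifying over \<open>l\<close> lets \<open>forall_5\<close> split into five
    concrete columns.\<close>
  have "\<forall>l. (M ** flip_base p) $ k $ l
      = (if l = 2 then 2 * p * M $ k $ 1 - M $ k $ 2 else M $ k $ l)"
    unfolding forall_5 by (simp add: flip_base_def matrix_matrix_mult_def sum_5)
  then show ?thesis by blast
qed

lemma flip_base_transpose_mult:
  "(transpose (flip_base p) ** M) $ k $ l =
    (if k = 2 then 2 * p * M $ 1 $ l - M $ 2 $ l else M $ k $ l)"
proof -
  have "(transpose (flip_base p) ** M) $ k $ l = (transpose M ** flip_base p) $ l $ k"
    by (simp add: matrix_matrix_mult_def transpose_def mult.commute)
  then show ?thesis by (simp add: mult_flip_base) (simp add: transpose_def)
qed

text \<open>Row 2 of the product gives 2 p q_j - r_j. The unit diagonal yields 2 p - p = p at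
  position (1,2) and 2 p p - (2 p p - 1) = 1 at position (2,2).\<close>

lemma flip_matrix_eq:
  assumes "transpose M = M" "M $ 1 $ 1 = 1" "M $ 2 $ 2 = 1"
  shows "flip_matrix M = transpose (flip_base (entry_p M)) ** M ** flip_base (entry_p M)"
proof -
  have sym: "M $ j $ i = M $ i $ j" for i j
    using arg_cong[OF assms(1), of "\<lambda>B. B $ i $ j"] by (simp add: transpose_def)
  show ?thesis
    unfolding vec_eq_iff mult_flip_base flip_base_transpose_mult forall_5
    by (simp add: flip_matrix_def entry_p_def entry_q_def entry_r_def assms(2,3)
        sym[of 1 2] sym[of 1 3] sym[of 1 4] sym[of 1 5] sym[of 2 3] sym[of 2 4] sym[of 2 5])
qed

lemma Xi5_form_ofI:
  assumes "transpose M = M" "\<And>x. form_of M x \<ge> 0" "rank M \<le> 4" "\<And>i. M $ i $ i = 1"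
  shows "form_of M \<in> Xi5"
  using assms by (auto simp: Xi5_def is_quadratic_form_def form_matrix_form_of)

lemma Xi5_cases:
  assumes "Q \<in> Xi5"
  obtains M where "transpose M = M" "Q = form_of M" "\<And>x. form_of M x \<ge> 0" "rank M \<le> 4"
    "\<And>i. M $ i $ i = 1"
  using assms by (auto simp: Xi5_def is_quadratic_form_def form_matrix_form_of)

lemma Xi5_flip_form_of: "transpose M = M \<Longrightarrow> Xi5_flip (form_of M) = form_of (flip_matrix M)"
  by (simp add: Xi5_flip_def form_matrix_form_of)

lemma Xi5_flip_Xi5:
  assumes "Q \<in> Xi5"
  shows "Xi5_flip Q \<in> Xi5"
proof -
  obtain M where M: "transpose M = M" "Q = form_of M" "\<And>x. form_of M x \<ge> 0" "rank M \<le> 4"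
    "\<And>i. M $ i $ i = 1" using Xi5_cases[OF assms] by blast
  note eq = flip_matrix_eq[OF M(1,5,5)]
  have "form_of (flip_matrix M) \<in> Xi5"
  proof (rule Xi5_form_ofI)
    show "transpose (flip_matrix M) = flip_matrix M"
      unfolding eq by (rule transpose_congruence[OF M(1)])
    show "form_of (flip_matrix M) x \<ge> 0" for x
      unfolding eq form_of_congruence by (rule M(3))
    show "rank (flip_matrix M) \<le> 4"
      unfolding eq by (meson M(4) order_trans rank_mul_le_left rank_mul_le_right)
    show "flip_matrix M $ i $ i = 1" for i
      using M(5)[of i] by (auto simp: flip_matrix_def)
  qed
  then show ?thesis by (simp add: M(1,2) Xi5_flip_form_of)
qed

subsection \<open>The spectral form as a Gram form\<close>

text \<open>The matrix of SU(2) with first row \<open>(a, b)\<close> is the unit vector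
  \<open>(Re a, Im a, Re b, Im b)\<close> of the three-sphere, and the determinant is the square of the norm.
  The bound 4 on the rank of the spectral form is the dimension of this space.\<close>

definition coords :: "complex^2^2^5 \<Rightarrow> real^5^4" where
  "coords g = (\<chi> k i. if k = 1 then Re (g $ i $ 1 $ 1) else if k = 2 then Im (g $ i $ 1 $ 1)
     else if k = 3 then Re (g $ i $ 1 $ 2) else Im (g $ i $ 1 $ 2))"

definition gram :: "complex^2^2^5 \<Rightarrow> real^5^5" where
  "gram g = transpose (coords g) ** coords g"

lemma gram_nth:
  "gram g $ i $ j = g $ i $ 1 $ 1 \<bullet> g $ j $ 1 $ 1 + g $ i $ 1 $ 2 \<bullet> g $ j $ 1 $ 2"
  by (simp add: gram_def coords_def matrix_matrix_mult_def transpose_def sum_4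
      inner_complex_def)

lemma transpose_gram: "transpose (gram g) = gram g"
  by (simp add: gram_def matrix_transpose_mul)

lemma form_of_gram: "form_of (gram g) x = (coords g *v x) \<bullet> (coords g *v x)"
  unfolding form_of_def gram_def matrix_vector_mul_assoc[symmetric] inner_transpose_mult ..

text \<open>The combination with coefficients \<open>x\<close> has first row with real coordinates
  \<open>coords g *v x\<close>, and by \<open>det_eq_norms\<close> its determinant is the squared
  length of that vector.\<close>

lemma spectral_form_gram:
  assumes "g \<in> SU2_tuples"
  shows "spectral_form g = form_of (gram g)"
proof
  fix x
  show "spectral_form g x = form_of (gram g) x"
    unfolding spectral_form_def det_eq_norms[OF assms] form_of_gram
    by (simp add: coords_def matrix_vector_mult_def inner_vec_def sum_4 cmod_power2
        mult.commute)
      (simp add: power2_eq_square)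
qed

text \<open>For the first row (a, b) of \<open>g $ i\<close> the entry is |a|^2 + |b|^2, which is
  the determinant of \<open>g $ i\<close>.\<close>

lemma gram_diag:
  assumes "g \<in> SU2_tuples"
  shows "gram g $ i $ i = 1"
proof -
  have *: "g $ i \<in> SU2" using assms by (simp add: SU2_tuples_def)
  then have "det (g $ i) = 1" by (simp add: SU2_def)
  then show ?thesis
    by (simp add: gram_nth det_2 SU2_entries[OF *] inner_complex_def complex_eq_iff)
qed

lemma spectral_form_Xi5:
  assumes "g \<in> SU2_tuples"
  shows "spectral_form g \<in> Xi5"
  unfolding spectral_form_gram[OF assms]
proof (rule Xi5_form_ofI)
  have "rank (gram g) \<le> rank (coords g)" unfolding gram_def by (rule rank_mul_le_right)
  also have "\<dots> \<le> 4" using rank_bound[of "coords g"] by simp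
  finally show "rank (gram g) \<le> 4" .
qed (simp_all add: transpose_gram form_of_gram gram_diag[OF assms])

lemma spectral_form_invert2:
  assumes "g \<in> SU2_tuples" "g $ 1 = mat 1"
  shows "spectral_form (invert2 g) = form_of (flip_matrix (gram g))"
proof
  fix x
  let ?p = "entry_p (gram g)"
  have g2: "g $ 2 \<in> SU2" using assms(1) by (simp add: SU2_tuples_def)
  \<comment> \<open>As \<open>g $ 1\<close> is the identity, \<open>?p\<close> is half the trace of
    \<open>g $ 2\<close>.\<close>
  have p: "?p = Re (g $ 2 $ 1 $ 1)"
    by (simp add: entry_p_def gram_nth assms(2) mat_def inner_complex_def)
  have "matrix_inv (g $ 2) = (2 * ?p) *\<^sub>R g $ 1 - g $ 2"
    by (simp add: matrix_inv_SU2[OF g2] adj_SU2_linear[OF g2] p assms(2))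
  \<comment> \<open>Collecting terms, g_1 receives the coefficient x_1 + 2 p x_2 and g_2 receives
    -x_2.\<close>
  then have "(\<Sum>i\<in>UNIV. x $ i *\<^sub>R invert2 g $ i)
      = (\<Sum>i\<in>UNIV. (flip_base ?p *v x) $ i *\<^sub>R g $ i)"
    by (simp add: sum_5 invert2_def flip_base_mult scaleR_left_distrib scaleR_right_diff_distrib
        mult_ac)
  then have "spectral_form (invert2 g) x = spectral_form g (flip_base ?p *v x)"
    by (simp add: spectral_form_def)
  also have "\<dots> = form_of (flip_matrix (gram g)) x"
    by (simp add: spectral_form_gram[OF assms(1)] form_of_congruence
        flip_matrix_eq[OF transpose_gram gram_diag[OF assms(1)] gram_diag[OF assms(1)]])
  finally show "spectral_form (invert2 g) x = form_of (flip_matrix (gram g)) x" .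
qed

text \<open>Uniqueness of the symmetric matrix of a form turns the equality of forms into one of
  matrices, from which the entries can be read off.\<close>

lemma form_matrix_invert2:
  assumes "g \<in> SU2_tuples" "g $ 1 = mat 1"
  shows "form_matrix (spectral_form (invert2 g)) = flip_matrix (form_matrix (spectral_form g))"
  unfolding spectral_form_invert2[OF assms] spectral_form_gram[OF assms(1)]
    form_matrix_form_of[OF transpose_gram]
    flip_matrix_eq[OF transpose_gram gram_diag[OF assms(1)] gram_diag[OF assms(1)]]
  by (rule form_matrix_form_of) (rule transpose_congruence[OF transpose_gram])

theorem proposition4p1:
  shows "(\<forall>g \<in> SU2_tuples. g $ 1 = mat 1 \<longrightarrow>
           (let M = form_matrix (spectral_form g);
                N = form_matrix (spectral_form (invert2 g))
            in entry_p N = entry_p M \<and>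
               (\<forall>j \<in> {1, 2, 3}. entry_q N j = entry_q M j) \<and>
               (\<forall>i \<in> {1, 2, 3}. \<forall>j \<in> {1, 2, 3}. i \<noteq> j \<longrightarrow> entry_t N i j = entry_t M i j) \<and>
               (\<forall>j \<in> {1, 2, 3}. entry_r N j = - entry_r M j + 2 * entry_p M * entry_q M j)) \<and>
           Pi5_invert2 (tuple_class g) = tuple_class (invert2 g))
       \<and> Pi5_invert2 \<in> Pi5 \<rightarrow> Pi5
       \<and> spectral_map \<in> Pi5 \<rightarrow> Xi5
       \<and> Xi5_flip \<in> Xi5 \<rightarrow> Xi5
       \<and> (\<forall>c \<in> Pi5. spectral_map (Pi5_invert2 c) = Xi5_flip (spectral_map c))"
proof (intro conjI ballI impI)
  fix g :: "complex^2^2^5"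
  assume g: "g \<in> SU2_tuples" "g $ 1 = mat 1"
  show "let M = form_matrix (spectral_form g);
            N = form_matrix (spectral_form (invert2 g))
        in entry_p N = entry_p M \<and>
           (\<forall>j \<in> {1, 2, 3}. entry_q N j = entry_q M j) \<and>
           (\<forall>i \<in> {1, 2, 3}. \<forall>j \<in> {1, 2, 3}. i \<noteq> j \<longrightarrow> entry_t N i j = entry_t M i j) \<and>
           (\<forall>j \<in> {1, 2, 3}. entry_r N j = - entry_r M j + 2 * entry_p M * entry_q M j)"
    \<comment> \<open>For j in {1, 2, 3} the index j + 2 is 3, 4 or 5 = 0, so the r_j are exactly
      the entries above the diagonal that the flip replaces.\<close>
    unfolding form_matrix_invert2[OF g] Let_def
    by (simp add: flip_matrix_def entry_p_def entry_q_def entry_r_def entry_t_def)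
  show "Pi5_invert2 (tuple_class g) = tuple_class (invert2 g)"
    by (rule Pi5_invert2_tuple_class[OF g])
next
  have class_Pi5: "tuple_class g \<in> Pi5" if "g \<in> SU2_tuples" for g
    using that by (simp add: Pi5_def tuple_class_def quotientI)
  show "Pi5_invert2 \<in> Pi5 \<rightarrow> Pi5"
  proof
    fix c assume "c \<in> Pi5"
    then show "Pi5_invert2 c \<in> Pi5"
      by (rule Pi5_cases) (simp add: Pi5_invert2_tuple_class class_Pi5 invert2_SU2_tuples)
  qed
  show "spectral_map \<in> Pi5 \<rightarrow> Xi5"
  proof
    fix c assume "c \<in> Pi5"
    then show "spectral_map c \<in> Xi5"
      by (rule Pi5_cases) (simp add: spectral_map_tuple_class spectral_form_Xi5)
  qed
  show "Xi5_flip \<in> Xi5 \<rightarrow> Xi5"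
    using Xi5_flip_Xi5 by blast
  show "spectral_map (Pi5_invert2 c) = Xi5_flip (spectral_map c)" if "c \<in> Pi5" for c
  proof -
    \<comment> \<open>On a normalized representative both sides become explicit, and
      \<open>spectral_form_invert2\<close> compares them.\<close>
    obtain g where g: "g \<in> SU2_tuples" "g $ 1 = mat 1" "c = tuple_class g"
      using \<open>c \<in> Pi5\<close> by (rule Pi5_cases)
    have "spectral_map (Pi5_invert2 c) = spectral_form (invert2 g)"
      by (simp add: g Pi5_invert2_tuple_class spectral_map_tuple_class invert2_SU2_tuples)
    also have "\<dots> = Xi5_flip (spectral_map c)"
      by (simp add: spectral_form_invert2[OF g(1,2)] g(3) spectral_map_tuple_class[OF g(1)]
          spectral_form_gram[OF g(1)] Xi5_flip_form_of transpose_gram)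
    finally show ?thesis .
  qed
qed

end
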